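(* Let $L,\ell>0$. For every $(L,\ell)$-bi-Lipschitz embedding $f\colon\mathbb{T}\to\mathbb{C}$ there exists a point $w_0\in\mathbb{C}$ such that $f-w_0$ admits a winding symmetrization (i.e. $0\notin (f-w_0)(\mathbb{T})$ and $(f-w_0)(\mathbb{T})$ separates $0$ from $\infty$) and the winding symmetrization of $f-w_0$ is a $(\pi L,\ \ell^2/(2\pi L))$-bi-Lipschitz map.
   Context: $\mathbb{T}=\{z\in\mathbb{C}:|z|=1\}$. For $X\subset\mathbb{C}$ and constants $L,\ell>0$, a map $f\colon X\to\mathbb{C}$ is an $(L,\ell)$-bi-Lipschitz embedding if $\ell|a-b|\le|f(a)-f(b)|\le L|a-b|$ for all $a,b\in X$. The winding map $W\colon\mathbb{C}\to\mathbb{C}$ is defined in polar coordinates by $W(re^{i\theta})=re^{2i\theta}$. Let $h\colon\mathbb{T}\to\mathbb{C}\setminus\{0\}$ be a homeomorphism onto its image such that $h(\mathbb{T})$ separates $0$ from $\infty$ (i.e. $0$ lies in the bounded component of $\mathbb{C}\setminus h(\mathbb{T})$). The winding symmetrization of $h$ is a homeomorphism (onto its image) $g\colon\mathbb{T}\to\mathbb{C}\setminus\{0\}$ such that $h\circ W=W\circ g$ on $\mathbb{T}$. Such a $g$ exists and is unique up to sign (both $g$ and $-g$ qualify). *)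

theory Defs
  imports "HOL-Analysis.Analysis"
begin

abbreviation unit_circle :: "complex set" where
  "unit_circle \<equiv> sphere 0 1"

definition bi_lipschitz_embedding ::
  "complex set \<Rightarrow> real \<Rightarrow> real \<Rightarrow> (complex \<Rightarrow> complex) \<Rightarrow> bool" where
  "bi_lipschitz_embedding X L l f \<longleftrightarrow>
     (\<forall>a\<in>X. \<forall>b\<in>X. l * cmod (a - b) \<le> cmod (f a - f b) \<and> cmod (f a - f b) \<le> L * cmod (a - b))"

definition winding_map :: "complex \<Rightarrow> complex" where
  "winding_map z = rcis (cmod z) (2 * Arg z)"

text \<open>The choice of argument is immaterial.\<close>

lemma winding_map_rcis:
  assumes "r \<ge> 0"
  shows "winding_map (rcis r t) = rcis r (2 * t)"
proof (cases "r = 0")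
  case True
  then show ?thesis by (simp add: winding_map_def)
next
  case False
  then have r: "r > 0" using assms by simp
  have "rcis r (Arg (rcis r t)) = rcis r t"
    using rcis_cmod_Arg[of "rcis r t"] r by simp
  then have "cis (Arg (rcis r t)) = cis t"
    using r by (simp add: rcis_def)
  then have "cis (2 * Arg (rcis r t)) = cis (2 * t)"
    by (metis cis_mult mult_2)
  then show ?thesis
    using r by (simp add: winding_map_def rcis_def norm_mult)
qed

definition embedding_on_circle :: "(complex \<Rightarrow> complex) \<Rightarrow> bool" where
  "embedding_on_circle h \<longleftrightarrow> (\<exists>k. homeomorphism unit_circle (h ` unit_circle) h k)"

text \<open>
  The maps to which winding symmetrization applies. A curve separates \<open>0\<close> from
  \<open>\<infinity>\<close> when \<open>0\<close> lies in a bounded component of its complement, which is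
  membership in \<^const>\<open>inside\<close>.
\<close>

definition winding_symmetrizable :: "(complex \<Rightarrow> complex) \<Rightarrow> bool" where
  "winding_symmetrizable h \<longleftrightarrow>
     embedding_on_circle h \<and> 0 \<notin> h ` unit_circle \<and> 0 \<in> inside (h ` unit_circle)"

text \<open>
  A relation rather than a function, since \<open>g\<close> is determined by \<open>h\<close> only up to sign.
  All maps are total; only their values on the circle matter.
\<close>

definition is_winding_symmetrization ::
  "(complex \<Rightarrow> complex) \<Rightarrow> (complex \<Rightarrow> complex) \<Rightarrow> bool" where
  "is_winding_symmetrization h g \<longleftrightarrow>
     embedding_on_circle g \<and> 0 \<notin> g ` unit_circle \<and>
     (\<forall>z\<in>unit_circle. h (winding_map z) = winding_map (g z))"

end

theory Submission
  imports Defs "HOL-Complex_Analysis.Complex_Analysis"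
begin

text \<open>
  The centre \<open>w0\<close> is a zero of a Lipschitz extension of \<open>f\<inverse>\<close> from the curve to the
  plane: without a zero inside the curve, normalising the extension would retract the closed
  inside onto the curve. The Lipschitz bound then keeps \<open>w0\<close> at distance at least
  \<open>l / sqrt 2\<close> from the curve. The symmetrization \<open>g\<close> is obtained by halving the imaginary
  part of a continuous logarithm of \<open>f - w0\<close>, whose winding number is \<open>1\<close> or \<open>- 1\<close>.

  The winding map \<open>W\<close> does not contract pairs of points at an acute angle, so \<open>g\<close> has Lipschitz
  constant \<open>2 * L\<close> along arcs, that is \<open>pi * L\<close> for chords. As \<open>W\<close> itself is 2-Lipschitz,
  \<open>2 * \<bar>g a - g b\<bar> \<ge> l * \<bar>a - b\<bar> * \<bar>a + b\<bar>\<close>; when \<open>a\<close> is close to \<open>- b\<close> this is weak, but then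
  oddness of \<open>g\<close> makes \<open>g a - g b\<close> close to \<open>2 * g a\<close>, which is at least \<open>sqrt 2 * l\<close> in modulus.
\<close>

section \<open>Tools: Lipschitz maps, and insides under translation\<close>

text \<open>McShane's construction: an infimum of the cones \<open>u y + M * dist x y\<close>
  inherits their Lipschitz constant, and over a point of \<open>S\<close> the cone with apex there
  is the lowest.\<close>

lemma mcshane_extension:
  fixes u :: "'a::metric_space \<Rightarrow> real"
  assumes "S \<noteq> {}" and M: "M \<ge> 0"
    and u: "\<And>x y. x \<in> S \<Longrightarrow> y \<in> S \<Longrightarrow> \<bar>u x - u y\<bar> \<le> M * dist x y"
  obtains v where "\<And>x. x \<in> S \<Longrightarrow> v x = u x"
    and "\<And>x y. \<bar>v x - v y\<bar> \<le> M * dist x y"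
proof
  define v where "v = (\<lambda>x. INF y\<in>S. u y + M * dist x y)"
  \<comment> \<open>Every downward cone lies below every upward cone. This bounds the infimum from
    below, and for \<open>z = x\<close> it gives \<open>u x \<le> v x\<close>.\<close>
  have lower: "u z - M * dist x z \<le> u y + M * dist x y" if "y \<in> S" "z \<in> S" for x y z
  proof -
    have "u z - u y \<le> M * dist z y"
      using u that by (metis abs_le_D1)
    also have "\<dots> \<le> M * (dist x z + dist x y)"
      using M dist_triangle3 mult_left_mono by blast
    finally show ?thesis
      by (simp add: algebra_simps)
  qed
  obtain z0 where z0: "z0 \<in> S"
    using \<open>S \<noteq> {}\<close> by blast
  have bdd: "bdd_below ((\<lambda>y. u y + M * dist x y) ` S)" for x
    using lower[OF _ z0, of _ x] by (intro bdd_belowI2)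
  show "v x = u x" if "x \<in> S" for x
  proof (rule antisym)
    show "v x \<le> u x"
      unfolding v_def using cINF_lower[OF bdd that, of x] by simp
    show "u x \<le> v x"
      unfolding v_def using lower[OF _ that, of _ x] \<open>S \<noteq> {}\<close> by (intro cINF_greatest) auto
  qed
  have half: "v x - M * dist x y \<le> v y" for x y
  proof -
    have "v x - M * dist x y \<le> u z + M * dist y z" if "z \<in> S" for z
    proof -
      have "v x \<le> u z + M * dist x z"
        unfolding v_def using cINF_lower[OF bdd that] by simp
      also have "\<dots> \<le> u z + M * (dist x y + dist y z)"
        using M dist_triangle mult_left_mono by (metis add_left_mono)
      finally show ?thesis
        by (simp add: algebra_simps)
    qed
    then show ?thesis
      using \<open>S \<noteq> {}\<close> by (simp add: v_def cINF_greatest)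
  qed
  show "\<bar>v x - v y\<bar> \<le> M * dist x y" for x y
    using half[of x y] half[of y x] by (simp add: dist_commute)
qed

text \<open>Real and imaginary parts are extended separately; recombining them costs the factor
  \<open>sqrt 2\<close>, which reappears in the distance \<open>l / sqrt 2\<close> between centre
  and curve.\<close>

lemma mcshane_extension_complex:
  fixes u :: "'a::metric_space \<Rightarrow> complex"
  assumes "S \<noteq> {}" and M: "M \<ge> 0"
    and u: "\<And>x y. x \<in> S \<Longrightarrow> y \<in> S \<Longrightarrow> cmod (u x - u y) \<le> M * dist x y"
  obtains v where "\<And>x. x \<in> S \<Longrightarrow> v x = u x"
    and "\<And>x y. cmod (v x - v y) \<le> sqrt 2 * M * dist x y"
proof -
  have re: "\<bar>Re (u x) - Re (u y)\<bar> \<le> M * dist x y"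
    and im: "\<bar>Im (u x) - Im (u y)\<bar> \<le> M * dist x y" if "x \<in> S" "y \<in> S" for x y
    using u[OF that] abs_Re_le_cmod[of "u x - u y"] abs_Im_le_cmod[of "u x - u y"] by auto
  obtain a where a: "\<And>x. x \<in> S \<Longrightarrow> a x = Re (u x)" "\<And>x y. \<bar>a x - a y\<bar> \<le> M * dist x y"
    using mcshane_extension[OF assms(1) M re] by blast
  obtain b where b: "\<And>x. x \<in> S \<Longrightarrow> b x = Im (u x)" "\<And>x y. \<bar>b x - b y\<bar> \<le> M * dist x y"
    using mcshane_extension[OF assms(1) M im] by blast
  show thesis
  proof
    show "Complex (a x) (b x) = u x" if "x \<in> S" for x
      using a b that by simp
    show "cmod (Complex (a x) (b x) - Complex (a y) (b y)) \<le> sqrt 2 * M * dist x y" for x y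
    proof -
      have "(a x - a y)\<^sup>2 \<le> (M * dist x y)\<^sup>2" "(b x - b y)\<^sup>2 \<le> (M * dist x y)\<^sup>2"
        using a(2) b(2) by (meson abs_le_square_iff abs_ge_self order_trans)+
      then have "(a x - a y)\<^sup>2 + (b x - b y)\<^sup>2 \<le> 2 * (M * dist x y)\<^sup>2"
        by simp
      then have "cmod (Complex (a x) (b x) - Complex (a y) (b y)) \<le> sqrt (2 * (M * dist x y)\<^sup>2)"
        by (simp add: cmod_def)
      also have "\<dots> = sqrt 2 * M * dist x y"
        using M by (simp add: real_sqrt_mult)
      finally show ?thesis .
    qed
  qed
qed

text \<open>Cut the segment from \<open>y\<close> to \<open>x\<close> into equal steps shorter than
  \<open>d\<close> and telescope. The constant survives because the step lengths add up to
  \<open>\<bar>x - y\<bar>\<close>.\<close>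

lemma local_lipschitz_const_imp_global:
  fixes G :: "real \<Rightarrow> 'a::real_normed_vector"
  assumes "d > 0"
    and G: "\<And>x y. \<bar>x - y\<bar> < d \<Longrightarrow> norm (G x - G y) \<le> M * \<bar>x - y\<bar>"
  shows "norm (G x - G y) \<le> M * \<bar>x - y\<bar>"
proof -
  obtain n :: nat where n: "\<bar>x - y\<bar> / d < n"
    using reals_Archimedean2 by blast
  then have "n > 0"
    using \<open>d > 0\<close> by (metis abs_ge_zero divide_nonneg_pos not_gr_zero not_less of_nat_0)
  define p where "p = (\<lambda>k::nat. y + real k * ((x - y) / n))"
  have step: "p (Suc k) - p k = (x - y) / n" for k
    by (simp add: p_def algebra_simps add_divide_distrib diff_divide_distrib)
  have "\<bar>(x - y) / n\<bar> < d"
    using n \<open>n > 0\<close> \<open>d > 0\<close> by (simp add: field_simps)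
  then have le: "norm (G (p (Suc k)) - G (p k)) \<le> M * (\<bar>x - y\<bar> / n)" for k
    using G[of "p (Suc k)" "p k"] by (simp add: step)
  have "G x - G y = G (p n) - G (p 0)"
    using \<open>n > 0\<close> by (simp add: p_def)
  also have "\<dots> = (\<Sum>k<n. G (p (Suc k)) - G (p k))"
    using sum_lessThan_telescope[of "\<lambda>k. G (p k)" n] by simp
  finally have "norm (G x - G y) \<le> (\<Sum>k<n. norm (G (p (Suc k)) - G (p k)))"
    by (simp add: norm_sum)
  also have "\<dots> \<le> (\<Sum>k<n. M * (\<bar>x - y\<bar> / n))"
    by (intro sum_mono le)
  also have "\<dots> = M * \<bar>x - y\<bar>"
    using \<open>n > 0\<close> by simp
  finally show ?thesis .
qed

text \<open>Translated back, the component of \<open>a + x\<close> is a connected set that contains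
  \<open>x\<close> and avoids \<open>S\<close>, so it lies in the bounded component of
  \<open>x\<close>.\<close>

lemma inside_translation:
  fixes S :: "'a::real_normed_vector set"
  assumes "x \<in> inside S"
  shows "a + x \<in> inside ((+) a ` S)"
proof -
  have x: "x \<notin> S" "bounded (connected_component_set (- S) x)"
    using assms by (auto simp: inside_def)
  let ?D = "connected_component_set (- (+) a ` S) (a + x)"
  have ax: "a + x \<in> - (+) a ` S"
    using x by auto
  have "(+) (- a) ` ?D \<subseteq> connected_component_set (- S) x"
  proof (rule connected_component_maximal)
    show "x \<in> (+) (- a) ` ?D"
      using ax by (intro image_eqI[of _ _ "a + x"]) (auto simp: connected_component_refl_eq)
    show "connected ((+) (- a) ` ?D)"
      by (intro connected_continuous_image continuous_intros) simp
    show "(+) (- a) ` ?D \<subseteq> - S"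
      using connected_component_subset[of "- (+) a ` S" "a + x"] by force
  qed
  then have "bounded ((+) (- a) ` ?D)"
    using x(2) bounded_subset by blast
  then have "bounded ((+) a ` (+) (- a) ` ?D)"
    by (rule bounded_translation)
  then have "bounded ?D"
    by (simp add: image_image)
  then show ?thesis
    using ax by (simp add: inside_def)
qed

section \<open>Chords and arcs of the unit circle\<close>

text \<open>Jordan's inequality: sine is concave on \<open>{0..pi/2}\<close>, so its graph lies
  above the chord between the endpoints.\<close>

lemma sin_ge_two_over_pi:
  assumes "0 \<le> x" "x \<le> pi / 2"
  shows "2 / pi * x \<le> sin x"
proof -
  have "convex_on {0..pi/2} (\<lambda>x. - sin x)"
    by (rule f''_ge0_imp_convex[where f' = "\<lambda>x. - cos x" and f'' = sin])
       (auto intro!: derivative_eq_intros sin_ge_zero)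
  from convex_onD[OF this, of "2 / pi * x" 0 "pi/2"]
  show ?thesis
    using assms by (simp add: field_simps)
qed

lemma cmod_cis_diff: "cmod (cis s - cis t) = 2 * \<bar>sin ((s - t) / 2)\<bar>"
proof -
  have "cis s - cis t = cis t * (exp (\<i> * of_real (s - t)) - 1)"
    unfolding cis_conv_exp[symmetric] by (simp add: cis_mult right_diff_distrib)
  then show ?thesis
    by (simp only: norm_mult norm_cis dist_exp_i_1 mult_1)
qed

lemma cmod_cis_diff_le: "cmod (cis s - cis t) \<le> \<bar>s - t\<bar>"
  using abs_sin_x_le_abs_x[of "(s - t) / 2"] by (simp add: cmod_cis_diff)

text \<open>Jordan's inequality at half the angle. The factor \<open>pi / 2\<close> later turns the
  constant \<open>2 * L\<close> along arcs into \<open>pi * L\<close> for chords.\<close>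

lemma cmod_cis_diff_ge:
  assumes "\<bar>s - t\<bar> \<le> pi"
  shows "\<bar>s - t\<bar> \<le> pi / 2 * cmod (cis s - cis t)"
proof -
  have "2 / pi * (\<bar>s - t\<bar> / 2) \<le> sin (\<bar>s - t\<bar> / 2)"
    using assms by (intro sin_ge_two_over_pi) auto
  moreover have "sin (\<bar>s - t\<bar> / 2) \<le> \<bar>sin ((s - t) / 2)\<bar>"
    using sin_minus[of "(s - t) / 2"] by (cases "s \<ge> t") (auto simp: minus_divide_left)
  ultimately have "2 / pi * (\<bar>s - t\<bar> / 2) \<le> \<bar>sin ((s - t) / 2)\<bar>"
    by linarith
  then show ?thesis
    by (simp add: cmod_cis_diff field_simps)
qed

section \<open>Metric properties of the winding map\<close>

text \<open>An algebraic form free of any branch of the argument; at \<open>0\<close> the convention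
  for division by zero gives the right value.\<close>

lemma winding_map_eq: "winding_map z = z\<^sup>2 / cmod z"
proof (cases "z = 0")
  case True
  then show ?thesis by (simp add: winding_map_def)
next
  case False
  have "winding_map z = cmod z * (cis (Arg z))\<^sup>2"
    by (simp add: winding_map_def rcis_def power2_eq_square cis_mult)
  with False show ?thesis
    by (simp add: cis_Arg sgn_eq power2_eq_square)
qed

lemma winding_map_unit: "cmod z = 1 \<Longrightarrow> winding_map z = z\<^sup>2"
  by (simp add: winding_map_eq)

lemma cmod_winding_map [simp]: "cmod (winding_map z) = cmod z"
  by (simp add: winding_map_def)

lemma winding_map_minus: "winding_map (- z) = winding_map z"
  by (simp add: winding_map_eq)

lemma winding_map_eq_iff: "winding_map z = winding_map w \<longleftrightarrow> z = w \<or> z = - w"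
proof
  assume eq: "winding_map z = winding_map w"
  then have "cmod z = cmod w"
    by (metis cmod_winding_map)
  with eq show "z = w \<or> z = - w"
    by (cases "w = 0") (auto simp: winding_map_eq power2_eq_iff)
qed (auto simp: winding_map_minus)

text \<open>Double-angle formula: the quotient is the cosine \<open>c\<close> of the angle between
  \<open>z\<close> and \<open>w\<close>; the winding map keeps moduli and doubles that angle, so the
  cosine becomes 2 c^2 - 1.\<close>

lemma inner_winding_map:
  assumes "z \<noteq> 0" "w \<noteq> 0"
  shows "inner (winding_map z) (winding_map w) =
    cmod z * cmod w * (2 * (inner z w / (cmod z * cmod w))\<^sup>2 - 1)"
proof -
  define r s where "r = cmod z" and "s = cmod w"
  have rs: "r > 0" "s > 0"
    using assms by (simp_all add: r_def s_def)
  have "inner (z\<^sup>2) (w\<^sup>2) = 2 * (inner z w)\<^sup>2 - (r * s)\<^sup>2"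
    by (simp add: r_def s_def inner_complex_def power_mult_distrib cmod_power2)
       (simp add: power2_eq_square algebra_simps)
  moreover have "winding_map z = (1 / r) *\<^sub>R z\<^sup>2" "winding_map w = (1 / s) *\<^sub>R w\<^sup>2"
    by (simp_all add: winding_map_eq r_def s_def scaleR_conv_of_real)
  ultimately show ?thesis
    using rs unfolding r_def[symmetric] s_def[symmetric]
    by (simp add: power_divide right_diff_distrib diff_divide_distrib) (simp add: power2_eq_square)
qed

lemma cmod_diff_square: "(cmod (z - w))\<^sup>2 = (cmod z)\<^sup>2 + (cmod w)\<^sup>2 - 2 * inner z w"
  by (simp add: power2_norm_eq_inner inner_diff inner_commute)

text \<open>Both distances involve the same moduli, so by the law of cosines it suffices to compare
  cosines: c - (2 c^2 - 1) = (1 - c) (1 + 2 c) is nonnegative for c between 0 and 1.\<close>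

lemma winding_map_expands:
  assumes "inner z w \<ge> 0"
  shows "cmod (z - w) \<le> cmod (winding_map z - winding_map w)"
proof (cases "z = 0 \<or> w = 0")
  case True
  then show ?thesis
    by (auto simp: winding_map_eq[of 0])
next
  case False
  define R where "R = cmod z * cmod w"
  define c where "c = inner z w / R"
  have R: "R > 0"
    using False by (simp add: R_def)
  have c: "0 \<le> c" "c \<le> 1"
    using assms R norm_cauchy_schwarz[of z w] by (simp_all add: c_def R_def)
  have ip: "inner z w = R * c"
    using R by (simp add: c_def)
  have "inner (winding_map z) (winding_map w) = R * (2 * c\<^sup>2 - 1)"
    using False inner_winding_map by (simp add: R_def c_def)
  moreover have "0 \<le> R * ((1 - c) * (1 + 2 * c))"
    using R c by simp
  ultimately have "(cmod (z - w))\<^sup>2 \<le> (cmod (winding_map z - winding_map w))\<^sup>2"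
    unfolding cmod_diff_square ip by (simp add: power2_eq_square algebra_simps)
  then show ?thesis
    by (simp add: power2_le_iff_abs_le)
qed

lemma winding_map_lipschitz: "cmod (winding_map z - winding_map w) \<le> 2 * cmod (z - w)"
proof (cases "z = 0 \<or> w = 0")
  case True
  then show ?thesis
    by (auto simp: winding_map_eq[of 0])
next
  case False
  define R where "R = cmod z * cmod w"
  define c where "c = inner z w / R"
  have R: "R > 0"
    using False by (simp add: R_def)
  have ip: "inner z w = R * c"
    using R by (simp add: c_def)
  have W: "inner (winding_map z) (winding_map w) = R * (2 * c\<^sup>2 - 1)"
    using False inner_winding_map by (simp add: R_def c_def)
  \<comment> \<open>The deficit splits into a radial and an angular square; this is the law of
    cosines on both sides with the squares completed.\<close>
  have "0 \<le> 3 * (cmod z - cmod w)\<^sup>2 + 4 * R * (1 - c)\<^sup>2"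
    using R by simp
  also have "\<dots> = (2 * cmod (z - w))\<^sup>2 - (cmod (winding_map z - winding_map w))\<^sup>2"
    unfolding power_mult_distrib cmod_diff_square W ip
    by (simp add: R_def power2_eq_square algebra_simps)
  finally have "(cmod (winding_map z - winding_map w))\<^sup>2 \<le> (2 * cmod (z - w))\<^sup>2"
    by simp
  then show ?thesis
    by (rule power2_le_imp_le) simp
qed

section \<open>Circle embeddings and closed paths\<close>

lemma embedding_on_circle_iff:
  "embedding_on_circle h \<longleftrightarrow> continuous_on unit_circle h \<and> inj_on h unit_circle"
proof
  assume "embedding_on_circle h"
  then show "continuous_on unit_circle h \<and> inj_on h unit_circle"
    by (auto simp: embedding_on_circle_def homeomorphism_def intro: inj_on_inverseI)
next
  assume "continuous_on unit_circle h \<and> inj_on h unit_circle"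
  then show "embedding_on_circle h"
    using homeomorphism_compact[of unit_circle h] by (simp add: embedding_on_circle_def)
qed

lemma bi_lipschitz_embedding_on_circle:
  assumes "bi_lipschitz_embedding unit_circle L l f" "l > 0"
  shows "embedding_on_circle f"
  unfolding embedding_on_circle_iff
proof
  \<comment> \<open>A Lipschitz constant must be nonnegative, and no sign of \<open>L\<close> is
    assumed here; hence \<open>max L 0\<close>.\<close>
  have "cmod (f a - f b) \<le> max L 0 * cmod (a - b)" if "a \<in> unit_circle" "b \<in> unit_circle" for a b
  proof -
    have "cmod (f a - f b) \<le> L * cmod (a - b)"
      using assms(1) that by (simp add: bi_lipschitz_embedding_def)
    also have "\<dots> \<le> max L 0 * cmod (a - b)"
      by (intro mult_right_mono) auto
    finally show ?thesis .
  qed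
  then show "continuous_on unit_circle f"
    by (intro lipschitz_on_continuous_on[of "max L 0"] lipschitz_onI) (auto simp: dist_norm)
  show "inj_on f unit_circle"
  proof (rule inj_onI)
    fix a b assume ab: "a \<in> unit_circle" "b \<in> unit_circle" "f a = f b"
    then have "l * cmod (a - b) \<le> cmod (f a - f b)"
      using assms(1) unfolding bi_lipschitz_embedding_def by blast
    with ab \<open>l > 0\<close> show "a = b"
      by (simp add: mult_le_0_iff)
  qed
qed

lemma circle_map_of_loop:
  assumes "path p" "pathfinish p = pathstart p"
  obtains g where "continuous_on unit_circle g"
    and "\<And>t. t \<in> {0..1} \<Longrightarrow> g (cis (2 * pi * t)) = p t"
proof
  let ?g = "p \<circ> (\<lambda>z. Arg2pi z / (2 * pi))"
  \<comment> \<open>The parameter \<open>Arg2pi z / (2 * pi)\<close> jumps at \<open>1\<close>.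
    Passing from loops to circle maps, applied to the homotopy of \<open>p\<close> with itself,
    yields continuity there too.\<close>
  have "homotopic_loops UNIV p p"
    using assms by (simp add: homotopic_loops_refl)
  then show "continuous_on unit_circle ?g"
    using homotopic_loops_imp_homotopic_circlemaps homotopic_with_imp_continuous by blast
  show "?g (cis (2 * pi * t)) = p t" if "t \<in> {0..1}" for t
  proof (cases "t = 1")
    \<comment> \<open>Here \<open>Arg2pi\<close> is \<open>0\<close> and not \<open>2 * pi\<close>,
      so the value obtained is \<open>p 0\<close>, equal to \<open>p 1\<close> because the path
      closes.\<close>
    case True
    then have "cis (2 * pi * t) = 1"
      by simp
    then show ?thesis
      using True assms Arg2pi_of_real[of 1] by (simp add: pathfinish_def pathstart_def)
  next
    case False
    with that have "Arg2pi (cis (2 * pi * t)) = 2 * pi * t"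
      by (intro Arg2pi_unique[of 1]) (auto simp: cis_conv_exp)
    then show ?thesis
      by simp
  qed
qed

lemma unit_circle_cis:
  assumes "z \<in> unit_circle"
  obtains t where "t \<in> {0..<1}" "z = cis (2 * pi * t)"
proof
  show "Arg2pi z / (2 * pi) \<in> {0..<1}"
    using Arg2pi_ge_0 Arg2pi_lt_2pi by simp
  show "z = cis (2 * pi * (Arg2pi z / (2 * pi)))"
    using assms Arg2pi_eq[of z] by (simp add: cis_conv_exp)
qed

text \<open>The Jordan curve theorem and winding numbers concern paths; this transfers them to
  circle maps. Freedom from self-crossings holds since parameters of one circle point differ by an
  integer.\<close>

lemma simple_path_circle_embedding:
  assumes "continuous_on unit_circle h" "inj_on h unit_circle"
  defines "p \<equiv> \<lambda>t. h (cis (2 * pi * t))"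
  shows "simple_path p" "pathfinish p = pathstart p" "path_image p = h ` unit_circle"
proof -
  have "continuous_on {0..1} p"
    unfolding p_def
    by (rule continuous_on_compose2[OF assms(1)]) (auto intro!: continuous_intros simp: cis_conv_exp)
  moreover have "loop_free p"
    unfolding loop_free_def
  proof (intro ballI impI)
    fix x y :: real assume xy: "x \<in> {0..1}" "y \<in> {0..1}" and "p x = p y"
    then have "cis (2 * pi * x) = cis (2 * pi * y)"
      using assms(2) by (auto simp: p_def dest: inj_onD)
    then have "cmod (cis (2 * pi * x) - cis (2 * pi * y)) = 0"
      by simp
    then have "sin ((x - y) * pi) = 0"
      by (simp add: cmod_cis_diff algebra_simps diff_divide_distrib)
    then have "x - y \<in> \<int>"
      using sin_times_pi_eq_0 by blast
    then obtain n where "x - y = of_int n"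
      by (auto elim: Ints_cases)
    moreover from this have "-1 \<le> n" "n \<le> 1"
      using xy by auto
    then have "n = -1 \<or> n = 0 \<or> n = 1"
      by auto
    ultimately show "x = y \<or> x = 0 \<and> y = 1 \<or> x = 1 \<and> y = 0"
      using xy by auto
  qed
  ultimately show "simple_path p"
    by (simp add: simple_path_def path_def)
  show "pathfinish p = pathstart p"
    by (simp add: pathfinish_def pathstart_def p_def)
  show "path_image p = h ` unit_circle"
  proof
    show "path_image p \<subseteq> h ` unit_circle"
      by (auto simp: path_image_def p_def)
    show "h ` unit_circle \<subseteq> path_image p"
    proof clarify
      fix z assume "z \<in> unit_circle"
      then obtain t where "t \<in> {0..<1}" "z = cis (2 * pi * t)"
        by (rule unit_circle_cis)
      then show "h z \<in> path_image p"
        by (auto simp: path_image_def p_def)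
    qed
  qed
qed

section \<open>Choice of the centre\<close>

lemma inside_point_far_from_curve:
  assumes "l > 0" and f: "bi_lipschitz_embedding unit_circle L l f"
  obtains w where "w \<in> inside (f ` unit_circle)"
    and "\<And>z. z \<in> unit_circle \<Longrightarrow> l / sqrt 2 \<le> cmod (f z - w)"
proof -
  let ?C = "f ` unit_circle"
  have low: "l * cmod (a - b) \<le> cmod (f a - f b)" if "a \<in> unit_circle" "b \<in> unit_circle" for a b
    using f that by (simp add: bi_lipschitz_embedding_def)
  have cont: "continuous_on unit_circle f" and inj: "inj_on f unit_circle"
    using bi_lipschitz_embedding_on_circle[OF f \<open>l > 0\<close>] by (simp_all add: embedding_on_circle_iff)
  have nonempty: "inside ?C \<noteq> {}"
    using Jordan_inside_outside simple_path_circle_embedding[OF cont inj] by metis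
  have comp: "compact ?C"
    using cont by (intro compact_continuous_image) auto
  define k where "k = inv_into unit_circle f"
  have k: "k (f z) = z" if "z \<in> unit_circle" for z
    using inj that by (simp add: k_def)
  have "cmod (k x - k y) \<le> 1 / l * dist x y" if "x \<in> ?C" "y \<in> ?C" for x y
    using that low \<open>l > 0\<close> by (auto simp: k dist_norm field_simps)
  then obtain F where F: "\<And>x. x \<in> ?C \<Longrightarrow> F x = k x"
    and lip: "\<And>x y. cmod (F x - F y) \<le> sqrt 2 * (1 / l) * dist x y"
    using mcshane_extension_complex[of ?C "1 / l" k] \<open>l > 0\<close>
    by (metis divide_nonneg_pos image_is_empty sphere_eq_empty not_one_less_zero zero_le_one)
  have contF: "continuous_on S F" for S
  proof -
    have "(sqrt 2 * (1 / l))-lipschitz_on S F"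
      using lip \<open>l > 0\<close> by (intro lipschitz_onI) (auto simp: dist_norm)
    then show ?thesis
      by (rule lipschitz_on_continuous_on)
  qed
  have cl: "closure (inside ?C) \<subseteq> ?C \<union> inside ?C"
    by (intro closure_inside_subset compact_imp_closed comp)
  have "\<exists>w \<in> inside ?C. F w = 0"
  proof (rule ccontr)
    assume no: "\<not> ?thesis"
    \<comment> \<open>Inside the curve this is the assumption being refuted; on the curve
      \<open>F\<close> agrees with \<open>k\<close>, whose values there have modulus 1.\<close>
    have nz: "F x \<noteq> 0" if "x \<in> closure (inside ?C)" for x
      using that cl no F k by fastforce
    have sgnF: "sgn (F x) \<in> unit_circle" if "x \<in> closure (inside ?C)" for x
      using nz[OF that] by (simp add: norm_sgn)
    have "continuous_on (closure (inside ?C)) (\<lambda>x. sgn (F x))"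
      using nz by (intro continuous_on_sgn contF) blast
    then have ret: "continuous_on (closure (inside ?C)) (\<lambda>x. f (sgn (F x)))"
      using sgnF continuous_on_compose2[OF cont] by blast
    have ret_image: "(\<lambda>x. f (sgn (F x))) \<in> inside ?C \<rightarrow> ?C"
      using sgnF closure_subset by blast
    have ret_id: "f (sgn (F x)) = x" if "x \<in> ?C" for x
      using that F k by (auto simp: sgn_eq)
    have "frontier (inside ?C) \<subseteq> ?C" "bounded (inside ?C)"
      using comp by (simp_all add: frontier_inside_subset compact_imp_closed bounded_inside compact_imp_bounded)
    \<comment> \<open>No-retraction principle: a bounded set whose closure is mapped continuously
      into a set containing its frontier, with that set fixed pointwise, must lie in it.\<close>
    then have "inside ?C \<subseteq> ?C"
      using frontier_subset_retraction[OF _ _ ret ret_image ret_id] by blast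
    then show False
      using nonempty inside_no_overlap by blast
  qed
  then obtain w where w: "w \<in> inside ?C" "F w = 0" by blast
  show thesis
  proof
    \<comment> \<open>\<open>F\<close> moves from modulus 1 at \<open>f z\<close> to
      \<open>0\<close> at \<open>w\<close>, while its Lipschitz constant is
      \<open>sqrt 2 / l\<close>.\<close>
    show "l / sqrt 2 \<le> cmod (f z - w)" if "z \<in> unit_circle" for z
      using lip[of "f z" w] F[of "f z"] k[OF that] that w \<open>l > 0\<close>
      by (simp add: dist_norm field_simps)
  qed (fact w)
qed

section \<open>Existence and oddness of the symmetrization\<close>

lemma winding_symmetrization_exists:
  assumes "winding_symmetrizable h"
  shows "\<exists>g. is_winding_symmetrization h g"
proof -
  have h: "continuous_on unit_circle h" "inj_on h unit_circle"
    and h0: "0 \<notin> h ` unit_circle" "0 \<in> inside (h ` unit_circle)"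
    using assms by (simp_all add: winding_symmetrizable_def embedding_on_circle_iff)
  define p where "p = (\<lambda>t. h (cis (2 * pi * t)))"
  have p: "simple_path p" "path_image p = h ` unit_circle"
    using simple_path_circle_embedding[OF h] by (simp_all add: p_def)
  have wn: "winding_number p 0 = 1 \<or> winding_number p 0 = - 1"
    using simple_closed_path_winding_number_inside[OF p(1)] h0 p(2) by metis
  obtain q where q: "path q" "\<And>t. t \<in> {0..1} \<Longrightarrow> p t = exp (q t)"
    and "pathfinish q - pathstart q = 2 * of_real pi * \<i> * winding_number p 0"
    using winding_number_as_continuous_log[of p 0] p h0(1) by (metis add_0 simple_path_imp_path)
  then have q1: "q 1 = q 0 + 2 * of_real pi * \<i> * winding_number p 0"
    by (simp add: pathfinish_def pathstart_def algebra_simps)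
  \<comment> \<open>\<open>E\<close> lifts the exponential through the winding map: it keeps the
    modulus and halves the angle.\<close>
  define E where "E = (\<lambda>w. exp (of_real (Re w) + \<i> * of_real (Im w / 2)))"
  have E: "E w = rcis (exp (Re w)) (Im w / 2)" for w
    by (simp add: E_def rcis_def exp_add exp_of_real cis_conv_exp)
  have WE: "winding_map (E w) = exp w" and E0: "E w \<noteq> 0" for w
  proof -
    show "winding_map (E w) = exp w"
      unfolding E by (subst winding_map_rcis) (auto simp: exp_eq_polar rcis_def)
    show "E w \<noteq> 0"
      by (simp add: E_def)
  qed
  \<comment> \<open>The logarithm changes by 2 pi i or its negative around the curve. Halved, this
    is a rotation by pi in either orientation, hence a change of sign.\<close>
  have E1: "E (q 1) = - E (q 0)"
  proof -
    have "cis (- pi) = - 1"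
      by (simp add: complex_eq_iff)
    with wn show ?thesis
      by (auto simp: E q1 rcis_def add_divide_distrib diff_divide_distrib simp flip: cis_mult cis_divide)
  qed
  define r where "r = (\<lambda>t. E (q t))"
  have r: "path r"
    using q(1) unfolding path_def r_def E_def by (intro continuous_intros) auto
  \<comment> \<open>By this sign change \<open>r\<close> followed by its negative is a closed loop;
    it covers the circle as an odd map.\<close>
  define P where "P = r +++ (\<lambda>t. - r t)"
  have "path P"
    unfolding P_def using r E1
    by (intro path_join_imp) (auto simp: pathfinish_def pathstart_def r_def path_def intro: continuous_intros)
  moreover have "pathfinish P = pathstart P"
    using E1 by (simp add: P_def pathfinish_def pathstart_def joinpaths_def r_def)
  ultimately obtain g where g: "continuous_on unit_circle g"
    and gP: "\<And>t. t \<in> {0..1} \<Longrightarrow> g (cis (2 * pi * t)) = P t"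
    by (rule circle_map_of_loop) blast
  have g_first: "g (cis (pi * t)) = r t" and g_second: "g (- cis (pi * t)) = - r t"
    if "t \<in> {0..1}" for t
  proof -
    show "g (cis (pi * t)) = r t"
      using gP[of "t / 2"] that by (simp add: P_def joinpaths_def)
    have "- cis (pi * t) = cis (2 * pi * ((t + 1) / 2))"
      by (simp add: distrib_left add_divide_distrib flip: cis_mult)
    \<comment> \<open>For \<open>t = 0\<close> the parameter 1/2 belongs to the first half of the
      join, with value \<open>r 1\<close>; \<open>E1\<close> identifies it with
      \<open>- r 0\<close>.\<close>
    then show "g (- cis (pi * t)) = - r t"
      using gP[of "(t + 1) / 2"] that E1
      by (auto simp: P_def joinpaths_def r_def field_simps)
  qed
  have half: "\<exists>t\<in>{0..1}. z = cis (pi * t) \<or> z = - cis (pi * t)" if "z \<in> unit_circle" for z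
  proof -
    from that obtain t where t: "t \<in> {0..<1}" "z = cis (2 * pi * t)"
      by (rule unit_circle_cis)
    show ?thesis
    proof (cases "t \<le> 1/2")
      case True
      with t show ?thesis by (intro bexI[of _ "2 * t"]) (auto simp: mult_ac)
    next
      case False
      have "- cis (pi * (2 * t - 1)) = z"
        using t by (simp add: right_diff_distrib cis_divide[symmetric] mult_ac)
      with t False show ?thesis by (intro bexI[of _ "2 * t - 1"]) auto
    qed
  qed
  have W: "h (winding_map z) = winding_map (g z)" and odd: "g (- z) = - g z" and nz: "g z \<noteq> 0"
    if z: "z \<in> unit_circle" for z
  proof -
    from half[OF z] obtain t where t: "t \<in> {0..1}" "z = cis (pi * t) \<or> z = - cis (pi * t)"
      by blast
    have "winding_map z = cis (2 * pi * t)"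
      using t(2) by (auto simp: winding_map_unit power2_eq_square cis_mult algebra_simps)
    then have "h (winding_map z) = exp (q t)"
      using q(2)[OF t(1)] by (simp add: p_def)
    then show "h (winding_map z) = winding_map (g z)"
      using t g_first[OF t(1)] g_second[OF t(1)] by (auto simp: r_def WE winding_map_minus)
    show "g (- z) = - g z" "g z \<noteq> 0"
      using t g_first[OF t(1)] g_second[OF t(1)] by (auto simp: r_def E0)
  qed
  have "inj_on g unit_circle"
  proof (rule inj_onI)
    fix z w assume z: "z \<in> unit_circle" and w: "w \<in> unit_circle" and eq: "g z = g w"
    then have "h (winding_map z) = h (winding_map w)"
      using W by simp
    then have "winding_map z = winding_map w"
      using h(2) z w by (auto dest: inj_onD)
    \<comment> \<open>If \<open>z = - w\<close>, oddness would give \<open>g w = - g w\<close>,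
      against \<open>g w \<noteq> 0\<close>.\<close>
    then show "z = w"
      using odd[OF w] nz[OF w] eq by (auto simp: winding_map_eq_iff)
  qed
  with g W nz show ?thesis
    by (auto simp: is_winding_symmetrization_def embedding_on_circle_iff)
qed

text \<open>The points \<open>z\<close> and \<open>- z\<close> have the same image under the winding
  map, so their values under \<open>g\<close> agree up to sign; injectivity excludes
  equality.\<close>

lemma winding_symmetrization_odd:
  assumes "is_winding_symmetrization h g" "z \<in> unit_circle"
  shows "g (- z) = - g z"
proof -
  have inj: "inj_on g unit_circle" and W: "\<And>z. z \<in> unit_circle \<Longrightarrow> h (winding_map z) = winding_map (g z)"
    using assms(1) by (auto simp: is_winding_symmetrization_def embedding_on_circle_iff)
  have "winding_map (g (- z)) = winding_map (g z)"
    using W[of z] W[of "- z"] assms(2) by (simp add: winding_map_minus)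
  moreover have "g (- z) \<noteq> g z"
    using inj assms(2) by (auto dest!: inj_onD[of g _ "- z" z])
  ultimately show ?thesis
    by (auto simp: winding_map_eq_iff)
qed

section \<open>The two Lipschitz bounds\<close>

lemma winding_symmetrization_lipschitz:
  assumes sym: "is_winding_symmetrization h g" and "L \<ge> 0"
    and h: "\<And>a b. a \<in> unit_circle \<Longrightarrow> b \<in> unit_circle \<Longrightarrow> cmod (h a - h b) \<le> L * cmod (a - b)"
    and a: "a \<in> unit_circle" and b: "b \<in> unit_circle"
  shows "cmod (g a - g b) \<le> pi * L * cmod (a - b)"
proof -
  have g: "continuous_on unit_circle g" and g0: "0 \<notin> g ` unit_circle"
    and W: "\<And>z. z \<in> unit_circle \<Longrightarrow> h (winding_map z) = winding_map (g z)"
    using sym by (auto simp: is_winding_symmetrization_def embedding_on_circle_iff)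
  have "compact (g ` unit_circle)"
    using g by (intro compact_continuous_image) auto
  then obtain e where e: "e > 0" "\<And>z. z \<in> unit_circle \<Longrightarrow> e \<le> cmod (g z)"
    using separate_point_closed[of "g ` unit_circle" 0] g0 compact_imp_closed by force
  have "uniformly_continuous_on unit_circle g"
    using g by (intro compact_uniformly_continuous) auto
  then obtain d where d: "d > 0"
    "\<And>z w. z \<in> unit_circle \<Longrightarrow> w \<in> unit_circle \<Longrightarrow> dist w z < d \<Longrightarrow> dist (g w) (g z) < e"
    using e(1) unfolding uniformly_continuous_on_def by metis
  \<comment> \<open>Values of \<open>g\<close> closer than the lower bound \<open>e\<close> of its
    modulus form an acute angle, so the winding map does not contract them; the factor 2 comes from
    the doubled angles of the arguments.\<close>
  have local: "cmod (g (cis s) - g (cis t)) \<le> 2 * L * \<bar>s - t\<bar>" if "\<bar>s - t\<bar> < d" for s t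
  proof -
    have "cmod (g (cis s) - g (cis t)) < e"
      using d(2)[of "cis t" "cis s"] cmod_cis_diff_le[of s t] that by (simp add: dist_norm)
    then have "(cmod (g (cis s) - g (cis t)))\<^sup>2 \<le> e\<^sup>2"
      by (simp add: power_mono)
    also have "\<dots> \<le> (cmod (g (cis s)))\<^sup>2 + (cmod (g (cis t)))\<^sup>2"
      using e power_mono[of e "cmod (g (cis s))" 2] by (simp add: add_increasing2)
    finally have "inner (g (cis s)) (g (cis t)) \<ge> 0"
      by (simp add: cmod_diff_square)
    then have "cmod (g (cis s) - g (cis t)) \<le> cmod (h (winding_map (cis s)) - h (winding_map (cis t)))"
      using winding_map_expands W by simp
    also have "\<dots> \<le> L * cmod (cis (2 * s) - cis (2 * t))"
      using h by (simp add: winding_map_unit power2_eq_square cis_mult)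
    also have "\<dots> \<le> L * \<bar>2 * s - 2 * t\<bar>"
      using \<open>L \<ge> 0\<close> by (intro mult_left_mono cmod_cis_diff_le)
    also have "\<bar>2 * s - 2 * t\<bar> = 2 * \<bar>s - t\<bar>"
      by (simp add: abs_if)
    finally show ?thesis
      by (simp add: mult_ac)
  qed
  have arc: "cmod (g (cis s) - g (cis t)) \<le> 2 * L * \<bar>s - t\<bar>" for s t
    using local_lipschitz_const_imp_global[of d "\<lambda>t. g (cis t)"] d(1) local by blast
  \<comment> \<open>The principal argument of \<open>b / a\<close> selects the shorter arc, of
    length at most pi.\<close>
  define s u where "s = Arg a" and "u = Arg (b / a)"
  have as: "a = cis s"
    using a cis_Arg[of a] by (force simp: s_def sgn_eq)
  have "b / a = cis u"
    using a b cis_Arg[of "b / a"] by (force simp: u_def sgn_eq norm_divide)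
  then have bs: "b = cis (s + u)"
    by (simp add: as cis_mult[symmetric] field_simps)
  have "\<bar>s - (s + u)\<bar> \<le> pi"
    using Arg_bounded[of "b / a"] by (auto simp: u_def)
  then have "\<bar>s - (s + u)\<bar> \<le> pi / 2 * cmod (a - b)"
    unfolding as bs by (rule cmod_cis_diff_ge)
  then have "2 * L * \<bar>s - (s + u)\<bar> \<le> 2 * L * (pi / 2 * cmod (a - b))"
    using \<open>L \<ge> 0\<close> by (intro mult_left_mono) auto
  with arc[of s "s + u"] show ?thesis
    unfolding as[symmetric] bs[symmetric] by (simp add: mult_ac)
qed

lemma winding_symmetrization_lower_bound:
  assumes sym: "is_winding_symmetrization h g" and "0 < l" "l \<le> L"
    and up: "\<And>a b. a \<in> unit_circle \<Longrightarrow> b \<in> unit_circle \<Longrightarrow> cmod (h a - h b) \<le> L * cmod (a - b)"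
    and low: "\<And>a b. a \<in> unit_circle \<Longrightarrow> b \<in> unit_circle \<Longrightarrow> l * cmod (a - b) \<le> cmod (h a - h b)"
    and far: "\<And>z. z \<in> unit_circle \<Longrightarrow> l / sqrt 2 \<le> cmod (h z)"
    and a: "a \<in> unit_circle" and b: "b \<in> unit_circle"
  shows "l\<^sup>2 / (2 * pi * L) * cmod (a - b) \<le> cmod (g a - g b)"
proof -
  have "L > 0"
    using assms by simp
  have W: "h (winding_map z) = winding_map (g z)" if "z \<in> unit_circle" for z
    using sym that by (simp add: is_winding_symmetrization_def)
  show ?thesis
  \<comment> \<open>The threshold serves both cases: above it the product bound gives exactly the
    claimed constant, and below it the upper Lipschitz bound at \<open>a\<close> and
    \<open>- b\<close> gives \<open>cmod (g a + g b) \<le> l\<close>.\<close>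
  proof (cases "cmod (a + b) \<ge> l / (pi * L)")
    case True
    have "l\<^sup>2 / (2 * pi * L) * cmod (a - b) = l / 2 * (l / (pi * L)) * cmod (a - b)"
      by (simp add: power2_eq_square)
    also have "\<dots> \<le> l / 2 * cmod (a + b) * cmod (a - b)"
      using True \<open>l > 0\<close> by (intro mult_left_mono mult_right_mono) auto
    also have "\<dots> = l * cmod (a\<^sup>2 - b\<^sup>2) / 2"
      by (simp add: power2_eq_square square_diff_square_factored norm_mult)
    also have "\<dots> \<le> cmod (h (a\<^sup>2) - h (b\<^sup>2)) / 2"
      using low a b by (simp add: norm_power)
    also have "\<dots> = cmod (winding_map (g a) - winding_map (g b)) / 2"
      using W[OF a] W[OF b] a b by (simp add: winding_map_unit)
    also have "\<dots> \<le> cmod (g a - g b)"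
      using winding_map_lipschitz[of "g a" "g b"] by simp
    finally show ?thesis .
  next
    case False
    have "g (- b) = - g b"
      using sym b by (rule winding_symmetrization_odd)
    then have "cmod (g a + g b) \<le> pi * L * cmod (a + b)"
      using winding_symmetrization_lipschitz[OF sym _ up a, of "- b"] b \<open>L > 0\<close> by simp
    also have "\<dots> \<le> l"
      using False \<open>L > 0\<close> by (simp add: field_simps)
    finally have "cmod (g a + g b) \<le> l" .
    moreover have "cmod (2 * g a) \<le> cmod (g a + g b) + cmod (g a - g b)"
      using norm_triangle_ineq[of "g a + g b" "g a - g b"] by simp
    moreover have "l / sqrt 2 \<le> cmod (g a)"
      using far[of "winding_map a"] W[OF a] a by (metis cmod_winding_map dist_0_norm mem_sphere)
    moreover have "l / sqrt 2 = sqrt 2 * l / 2"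
      using real_sqrt_mult_self[of 2] by (simp add: field_simps)
    ultimately have "sqrt 2 * l - l \<le> cmod (g a - g b)"
      by (simp add: norm_mult)
    \<comment> \<open>One third separates the two sides: \<open>sqrt 2\<close> exceeds 4/3, while pi
      exceeds 3 and chords are at most 2.\<close>
    moreover have "(sqrt 2 - 1) * l \<ge> 1 / 3 * l"
      using real_le_rsqrt[of "4/3" 2] \<open>l > 0\<close> by (intro mult_right_mono) (auto simp: power2_eq_square)
    moreover have "l\<^sup>2 / (2 * pi * L) * cmod (a - b) \<le> 1 / 3 * l"
    proof -
      have "cmod (a - b) \<le> 2"
        using norm_triangle_ineq4[of a b] a b by simp
      then have "l\<^sup>2 / (2 * pi * L) * cmod (a - b) \<le> l\<^sup>2 / (2 * pi * L) * 2"
        using \<open>L > 0\<close> by (intro mult_left_mono) auto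
      also have "\<dots> = l * (l / L) * (1 / pi)"
        by (simp add: power2_eq_square)
      also have "\<dots> \<le> l * 1 * (1 / 3)"
        using \<open>l > 0\<close> \<open>l \<le> L\<close> pi_gt3 by (intro mult_mono) (auto simp: field_simps)
      finally show ?thesis by simp
    qed
    ultimately show ?thesis
      by (simp add: algebra_simps)
  qed
qed

theorem corollary8p6:
  fixes L l :: real and f :: "complex \<Rightarrow> complex"
  assumes "L > 0" and "l > 0"
    and "bi_lipschitz_embedding unit_circle L l f"
  shows "\<exists>w0. winding_symmetrizable (\<lambda>z. f z - w0) \<and>
    (\<exists>g. is_winding_symmetrization (\<lambda>z. f z - w0) g) \<and>
    (\<forall>g. is_winding_symmetrization (\<lambda>z. f z - w0) g \<longrightarrow>
       bi_lipschitz_embedding unit_circle (pi * L) (l\<^sup>2 / (2 * pi * L)) g)"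
proof -
  have up: "cmod (f a - f b) \<le> L * cmod (a - b)" and low: "l * cmod (a - b) \<le> cmod (f a - f b)"
    if "a \<in> unit_circle" "b \<in> unit_circle" for a b
    using assms(3) that by (simp_all add: bi_lipschitz_embedding_def)
  \<comment> \<open>Any two distinct points of the circle compare the constants; an antipodal pair
    is used.\<close>
  have "l \<le> L"
    using order_trans[OF low[of 1 "-1"] up[of 1 "-1"]] by simp
  have cont: "continuous_on unit_circle f" and inj: "inj_on f unit_circle"
    using bi_lipschitz_embedding_on_circle[OF assms(3) \<open>l > 0\<close>] by (simp_all add: embedding_on_circle_iff)
  obtain w0 where w0: "w0 \<in> inside (f ` unit_circle)"
    and far: "\<And>z. z \<in> unit_circle \<Longrightarrow> l / sqrt 2 \<le> cmod (f z - w0)"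
    using inside_point_far_from_curve[OF \<open>l > 0\<close> assms(3)] by blast
  let ?h = "\<lambda>z. f z - w0"
  have image: "?h ` unit_circle = (\<lambda>x. - w0 + x) ` f ` unit_circle"
    by (auto simp: image_image)
  have "0 \<in> inside (?h ` unit_circle)"
    unfolding image using inside_translation[OF w0, of "- w0"] by simp
  moreover have "embedding_on_circle ?h"
    using cont inj by (auto simp: embedding_on_circle_iff inj_on_def intro: continuous_intros)
  ultimately have sym: "winding_symmetrizable ?h"
    using inside_no_overlap unfolding winding_symmetrizable_def by blast
  have "bi_lipschitz_embedding unit_circle (pi * L) (l\<^sup>2 / (2 * pi * L)) g"
    if g: "is_winding_symmetrization ?h g" for g
    unfolding bi_lipschitz_embedding_def
    using winding_symmetrization_lower_bound[OF g \<open>l > 0\<close> \<open>l \<le> L\<close>]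
      winding_symmetrization_lipschitz[OF g less_imp_le[OF \<open>L > 0\<close>]] up low far by simp
  with sym winding_symmetrization_exists[OF sym] show ?thesis
    by blast
qed

end
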